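(* Let $(\mathcal G_i,e_i)$, $i\in I$, be a finite family of rooted graphs and let $A$ be the adjacency operator of their free product $*_{i\in I}\mathcal G_i$ on $\mathcal H_I=l_2( *_{i\in I}V_i)$. For $i\in I$ let $A^{(i)}=\sum_{n=1}^\infty A_i(n)$. Then the series defining $A^{(i)}$ converges strongly (on the linear span of the vectors $\delta(w)$, $w\in *_{i\in I}V_i$) for every $i\in I$, $A=\sum_{i\in I}A^{(i)}$, and the operators $A^{(i)}$, $i\in I$, are freely independent with respect to the vacuum state $\varphi(T)=\langle T\delta(e),\delta(e)\rangle$ (i.e. the unital algebras of polynomials in $A^{(i)}$, $i\in I$, acting on finitely supported vectors, are free with respect to $\varphi$).
   Context: A graph is a non-oriented connected locally finite simple graph with nonempty edge set; a rooted graph $(\mathcal G_i,e_i)=(V_i,E_i,e_i)$; $V_i^0=V_i\setminus\{e_i\}$. The free product $*_{i\in I}V_i$ consists of the empty word $e$ and words $v_1\cdots v_m$ with $v_k\in V_{i_k}^0$, consecutive indices distinct; each $e_i$ is identified with the empty word. The free product graph $*_{i\in I}\mathcal G_i$ has vertex set $*_{i\in I}V_i$, root $e$, and edges $\{vu,v'u\}$ with $\{v,v'\}\in\bigcup_iE_i$ and $u,vu,v'u\in *_{i\in I}V_i$. The adjacency operator acts on finitely supported functions by $A\delta(x)=\sum_{x'\sim x}\delta(x')$. For $j\in I$, $n\ge1$, let $W_j(n)$ be the set of words of length $n$ whose first letter is not in $V_j^0$, and $W_j(0)=\{e\}$. Define $A_i(n)$ by its matrix: $(A_i(n))_{w,w'}=1$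 if $\{w,w'\}=\{xu,x'u\}$ for some $\{x,x'\}\in E_i$ and $u\in W_i(n-1)$ (with $e_iu=u$), and $0$ otherwise. *)

theory Defs
  imports "HOL-Analysis.Infinite_Sum" "HOL-Computational_Algebra.Polynomial"
begin

section \<open>Rooted graphs\<close>

definition simple_graph :: "'a set \<Rightarrow> 'a set set \<Rightarrow> bool" where
  "simple_graph V E \<longleftrightarrow> (\<forall>f\<in>E. f \<subseteq> V \<and> card f = 2)"

definition connected_graph :: "'a set \<Rightarrow> 'a set set \<Rightarrow> bool" where
  "connected_graph V E \<longleftrightarrow> (\<forall>x\<in>V. \<forall>y\<in>V. (x, y) \<in> {(u, v). {u, v} \<in> E}\<^sup>*)"

definition neighbours :: "'a set set \<Rightarrow> 'a \<Rightarrow> 'a set" where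
  "neighbours E x = {x'. {x, x'} \<in> E}"

definition rooted_graph :: "'a set \<Rightarrow> 'a set set \<Rightarrow> 'a \<Rightarrow> bool" where
  "rooted_graph V E rt \<longleftrightarrow> simple_graph V E \<and> connected_graph V E \<and>
     (\<forall>x\<in>V. finite (neighbours E x)) \<and> E \<noteq> {} \<and> rt \<in> V"


section \<open>The free product of rooted graphs\<close>

text \<open>
  All vertex sets live in one type and need not be disjoint, so a letter \<open>v \<in> V i - {rt i}\<close>
  is stored as the pair \<open>(i, v)\<close>. The empty list is the empty word.
\<close>

type_synonym ('i, 'a) word = "('i \<times> 'a) list"

definition free_words :: "'i set \<Rightarrow> ('i \<Rightarrow> 'a set) \<Rightarrow> ('i \<Rightarrow> 'a) \<Rightarrow> ('i, 'a) word set" where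
  "free_words I V rt = {w. (\<forall>(i, v)\<in>set w. i \<in> I \<and> v \<in> V i - {rt i}) \<and> distinct_adj (map fst w)}"

text \<open>
  The word \<open>vu\<close> for \<open>v \<in> V i\<close>, where the root \<open>rt i\<close> is identified with the empty word.
  The result need not be reduced, even if \<open>u\<close> is.
\<close>

definition lmult :: "('i \<Rightarrow> 'a) \<Rightarrow> 'i \<Rightarrow> 'a \<Rightarrow> ('i, 'a) word \<Rightarrow> ('i, 'a) word" where
  "lmult rt i v u = (if v = rt i then u else (i, v) # u)"

definition free_edges ::
    "'i set \<Rightarrow> ('i \<Rightarrow> 'a set) \<Rightarrow> ('i \<Rightarrow> 'a set set) \<Rightarrow> ('i \<Rightarrow> 'a) \<Rightarrow> ('i, 'a) word set set" where
  "free_edges I V E rt =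
     {{lmult rt i v u, lmult rt i v' u} | i v v' u.
        i \<in> I \<and> {v, v'} \<in> E i \<and> u \<in> free_words I V rt \<and>
        lmult rt i v u \<in> free_words I V rt \<and> lmult rt i v' u \<in> free_words I V rt}"

text \<open>
  Words of length \<open>n\<close> not starting with a letter from \<open>V j - {rt j}\<close>; for \<open>n = 0\<close> this is
  \<open>{[]}\<close>.
\<close>

definition words_avoiding ::
    "'i set \<Rightarrow> ('i \<Rightarrow> 'a set) \<Rightarrow> ('i \<Rightarrow> 'a) \<Rightarrow> 'i \<Rightarrow> nat \<Rightarrow> ('i, 'a) word set" where
  "words_avoiding I V rt j n =
     {w \<in> free_words I V rt. length w = n \<and> (w \<noteq> [] \<longrightarrow> fst (hd w) \<noteq> j)}"


section \<open>Square-summable and finitely supported functions\<close>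

text \<open>Functions on a set \<open>X\<close> are total functions vanishing outside \<open>X\<close>.\<close>

definition l2_space :: "'w set \<Rightarrow> ('w \<Rightarrow> complex) set" where
  "l2_space X = {f. (\<forall>w. w \<notin> X \<longrightarrow> f w = 0) \<and> (\<lambda>w. (norm (f w))\<^sup>2) summable_on X}"

definition l2_inner :: "'w set \<Rightarrow> ('w \<Rightarrow> complex) \<Rightarrow> ('w \<Rightarrow> complex) \<Rightarrow> complex" where
  "l2_inner X f g = (\<Sum>\<^sub>\<infinity>w\<in>X. f w * cnj (g w))"

definition l2_norm :: "'w set \<Rightarrow> ('w \<Rightarrow> complex) \<Rightarrow> real" where
  "l2_norm X f = sqrt (\<Sum>\<^sub>\<infinity>w\<in>X. (norm (f w))\<^sup>2)"

definition supp :: "('w \<Rightarrow> complex) \<Rightarrow> 'w set" where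
  "supp f = {w. f w \<noteq> 0}"

definition delta :: "'w \<Rightarrow> 'w \<Rightarrow> complex" where
  "delta w = (\<lambda>v. if v = w then 1 else 0)"

text \<open>The linear span of the vectors \<open>delta w\<close>, \<open>w \<in> X\<close>.\<close>

definition fin_supp :: "'w set \<Rightarrow> ('w \<Rightarrow> complex) set" where
  "fin_supp X = {f. finite (supp f) \<and> supp f \<subseteq> X}"


section \<open>Operators on finitely supported functions\<close>

text \<open>
  An operator is a total map on functions of which only the restriction to
  \<^term>\<open>fin_supp X\<close> is meaningful.
\<close>

type_synonym 'w oper = "('w \<Rightarrow> complex) \<Rightarrow> ('w \<Rightarrow> complex)"

definition linear_operator_on :: "('w \<Rightarrow> complex) set \<Rightarrow> 'w oper \<Rightarrow> bool" where
  "linear_operator_on D T \<longleftrightarrow> (\<forall>\<xi>\<in>D. T \<xi> \<in> D) \<and>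
     (\<forall>\<xi>\<in>D. \<forall>\<eta>\<in>D. T (\<lambda>w. \<xi> w + \<eta> w) = (\<lambda>w. T \<xi> w + T \<eta> w)) \<and>
     (\<forall>c. \<forall>\<xi>\<in>D. T (\<lambda>w. c * \<xi> w) = (\<lambda>w. c * T \<xi> w))"

text \<open>The linear extension of \<open>delta x \<mapsto> (\<Sum>x'\<in>neighbours G x. delta x')\<close>.\<close>

definition adjacency_op :: "'w set set \<Rightarrow> 'w oper" where
  "adjacency_op G \<xi> = (\<lambda>y. \<Sum>x\<in>supp \<xi>. \<xi> x * (\<Sum>x'\<in>neighbours G x. delta x' y))"

definition matrix_op :: "('w \<Rightarrow> 'w \<Rightarrow> complex) \<Rightarrow> 'w oper" where
  "matrix_op M \<xi> = (\<lambda>w. \<Sum>w'\<in>supp \<xi>. M w w' * \<xi> w')"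

definition poly_op :: "complex poly \<Rightarrow> 'w oper \<Rightarrow> 'w oper" where
  "poly_op p T \<xi> = (\<lambda>w. \<Sum>k\<le>degree p. coeff p k * (T ^^ k) \<xi> w)"

definition generated_algebra :: "'w oper \<Rightarrow> 'w oper set" where
  "generated_algebra T = {poly_op p T | p. True}"


section \<open>Strong convergence of series of operators\<close>

text \<open>Series start at \<open>n = 1\<close>; convergence is in the norm of \<open>l2_space X\<close>.\<close>

definition l2_series_limit :: "'w set \<Rightarrow> (nat \<Rightarrow> 'w \<Rightarrow> complex) \<Rightarrow> ('w \<Rightarrow> complex) \<Rightarrow> bool" where
  "l2_series_limit X f \<eta> \<longleftrightarrow> (\<forall>n\<ge>1. f n \<in> l2_space X) \<and> \<eta> \<in> l2_space X \<and>
     (\<lambda>N. l2_norm X (\<lambda>w. (\<Sum>n=1..N. f n w) - \<eta> w)) \<longlonglongrightarrow> 0"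

definition series_converges_strongly :: "'w set \<Rightarrow> (nat \<Rightarrow> 'w oper) \<Rightarrow> bool" where
  "series_converges_strongly X T \<longleftrightarrow>
     (\<forall>\<xi>\<in>fin_supp X. \<exists>\<eta>. l2_series_limit X (\<lambda>n. T n \<xi>) \<eta>)"

definition strong_series :: "'w set \<Rightarrow> (nat \<Rightarrow> 'w oper) \<Rightarrow> 'w oper" where
  "strong_series X T \<xi> = (THE \<eta>. l2_series_limit X (\<lambda>n. T n \<xi>) \<eta>)"


section \<open>Free independence\<close>

definition vacuum_state :: "('i, 'a) word set \<Rightarrow> ('i, 'a) word oper \<Rightarrow> complex" where
  "vacuum_state X T = l2_inner X (T (delta [])) (delta [])"

definition free_algebras :: "('w oper \<Rightarrow> complex) \<Rightarrow> 'i set \<Rightarrow> ('i \<Rightarrow> 'w oper set) \<Rightarrow> bool" where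
  "free_algebras \<phi> I \<A> \<longleftrightarrow>
     (\<forall>is as. is \<noteq> [] \<and> length as = length is \<and> set is \<subseteq> I \<and> distinct_adj is \<and>
        (\<forall>k<length is. as ! k \<in> \<A> (is ! k) \<and> \<phi> (as ! k) = 0)
        \<longrightarrow> \<phi> (foldr (\<circ>) as id) = 0)"

text \<open>
  Free independence of a family of elements of the algebra of linear operators on \<open>D\<close>;
  membership in that algebra is part of the definition.
\<close>

definition freely_independent ::
    "('w \<Rightarrow> complex) set \<Rightarrow> ('w oper \<Rightarrow> complex) \<Rightarrow> 'i set \<Rightarrow> ('i \<Rightarrow> 'w oper) \<Rightarrow> bool" where
  "freely_independent D \<phi> I T \<longleftrightarrow>
     (\<forall>i\<in>I. linear_operator_on D (T i)) \<and> free_algebras \<phi> I (\<lambda>i. generated_algebra (T i))"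


section \<open>The operators of the decomposition\<close>

definition A_level ::
    "'i set \<Rightarrow> ('i \<Rightarrow> 'a set) \<Rightarrow> ('i \<Rightarrow> 'a set set) \<Rightarrow> ('i \<Rightarrow> 'a) \<Rightarrow> 'i \<Rightarrow> nat
      \<Rightarrow> ('i, 'a) word oper" where
  "A_level I V E rt i n = matrix_op (\<lambda>w w'.
     if \<exists>x x' u. {x, x'} \<in> E i \<and> u \<in> words_avoiding I V rt i (n - 1) \<and>
          {w, w'} = {lmult rt i x u, lmult rt i x' u}
     then 1 else 0)"

definition A_component ::
    "'i set \<Rightarrow> ('i \<Rightarrow> 'a set) \<Rightarrow> ('i \<Rightarrow> 'a set set) \<Rightarrow> ('i \<Rightarrow> 'a) \<Rightarrow> 'i \<Rightarrow> ('i, 'a) word oper" where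
  "A_component I V E rt i = strong_series (free_words I V rt) (A_level I V E rt i)"

end

theory Submission imports Defs begin

text \<open>
  Splitting a reduced word as \<open>w = v u\<close> with \<open>v \<in> V i\<close> and \<open>u\<close> not starting with a letter
  of index \<open>i\<close> identifies the free product of the vertex sets with \<open>V i\<close> times the set of such
  words \<open>u\<close>, and \<open>A_component i\<close> becomes the adjacency operator of the \<open>i\<close>-th graph acting on
  the first factor. On a finitely supported vector only finitely many levels contribute, which
  gives the convergence.
  For a polynomial \<open>a\<close> in this operator and a vector \<open>\<xi>\<close> supported on words not starting with
  index \<open>i\<close>, the value of \<open>a \<xi>\<close> at \<open>u\<close> is therefore \<open>\<phi>(a)\<close> times \<open>\<xi> u\<close>. Hence if
  \<open>\<phi>(a) = 0\<close>, then \<open>a \<xi>\<close> is supported on words starting with index \<open>i\<close>; by induction, an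
  alternating product of centred polynomials maps the vacuum vector to a vector supported on
  nonempty words.
\<close>

section \<open>Square-summable and finitely supported functions\<close>

lemma sum_delta_eq: "finite N \<Longrightarrow> (\<Sum>x\<in>N. delta x y) = of_bool (y \<in> N)"
  by (simp add: delta_def)

lemma fin_supp_in_l2_space:
  assumes "f \<in> fin_supp X"
  shows "f \<in> l2_space X"
proof -
  have "(\<lambda>w. (norm (f w))\<^sup>2) summable_on X \<longleftrightarrow> (\<lambda>w. (norm (f w))\<^sup>2) summable_on supp f"
    by (rule summable_on_cong_neutral) (use assms in \<open>auto simp: supp_def fin_supp_def\<close>)
  with assms show ?thesis
    by (auto simp: l2_space_def fin_supp_def supp_def)
qed

lemma l2_space_diff_summable:
  assumes "f \<in> l2_space X" "g \<in> l2_space X"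
  shows "(\<lambda>w. (norm (f w - g w))\<^sup>2) summable_on X"
proof (rule summable_on_comparison_test)
  show "(\<lambda>w. 2 * (norm (f w))\<^sup>2 + 2 * (norm (g w))\<^sup>2) summable_on X"
    using assms by (auto simp: l2_space_def intro!: summable_on_add summable_on_cmult_right)
  show "(norm (f w - g w))\<^sup>2 \<le> 2 * (norm (f w))\<^sup>2 + 2 * (norm (g w))\<^sup>2" for w
  proof -
    have "(norm (f w - g w))\<^sup>2 \<le> (norm (f w) + norm (g w))\<^sup>2"
      by (intro power_mono norm_triangle_ineq4) simp
    also have "\<dots> \<le> 2 * (norm (f w))\<^sup>2 + 2 * (norm (g w))\<^sup>2"
      using sum_squares_bound[of "norm (f w)" "norm (g w)"] by (simp add: power2_sum)
    finally show ?thesis .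
  qed
qed auto

text \<open>Membership in \<open>l2_space\<close> excludes a norm that is 0 only because
  \<open>infsum\<close> of a non-summable family defaults to 0. As members vanish outside
  \<open>X\<close>, equality holds for total functions. This makes limits unique.\<close>

lemma l2_norm_diff_eq_0D:
  assumes "f \<in> l2_space X" "g \<in> l2_space X" "l2_norm X (\<lambda>w. f w - g w) = 0"
  shows "f = g"
proof
  fix w
  show "f w = g w"
  proof (cases "w \<in> X")
    case True
    have "(norm (f w - g w))\<^sup>2 = 0"
      by (rule nonneg_infsum_le_0D[OF _ l2_space_diff_summable[OF assms(1,2)] _ True])
         (use assms(3) in \<open>auto simp: l2_norm_def\<close>)
    then show ?thesis by simp
  qed (use assms in \<open>auto simp: l2_space_def\<close>)
qed

text \<open>The norms become constant, equal to the norm of the difference of eta and zeta, so they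
  tend to 0 only if both agree. The equivalence serves both for existence and for evaluating the
  \<open>THE\<close> in \<open>strong_series\<close>.\<close>

lemma l2_series_limit_of_eventually_constant:
  assumes "\<And>n. 1 \<le> n \<Longrightarrow> f n \<in> l2_space X" "\<eta> \<in> l2_space X"
    and ev: "\<forall>\<^sub>F N in sequentially. \<forall>w. (\<Sum>n=1..N. f n w) = \<eta> w"
  shows "l2_series_limit X f \<zeta> \<longleftrightarrow> \<zeta> = \<eta>"
proof -
  have lim: "(\<lambda>N. l2_norm X (\<lambda>w. (\<Sum>n=1..N. f n w) - \<theta> w)) \<longlonglongrightarrow> l2_norm X (\<lambda>w. \<eta> w - \<theta> w)" for \<theta>
    by (rule tendsto_eventually) (use ev in \<open>auto elim: eventually_mono\<close>)
  have zero: "l2_norm X (\<lambda>w. \<eta> w - \<eta> w) = 0"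
    by (simp add: l2_norm_def)
  show ?thesis
  proof
    assume "l2_series_limit X f \<zeta>"
    then have "\<zeta> \<in> l2_space X" "l2_norm X (\<lambda>w. \<eta> w - \<zeta> w) = 0"
      using LIMSEQ_unique[OF lim] by (auto simp: l2_series_limit_def)
    then show "\<zeta> = \<eta>"
      using l2_norm_diff_eq_0D assms(2) by metis
  next
    assume "\<zeta> = \<eta>"
    then show "l2_series_limit X f \<zeta>"
      using assms lim[of \<eta>] zero by (simp add: l2_series_limit_def)
  qed
qed

lemma vacuum_state_eq:
  assumes "[] \<in> X"
  shows "vacuum_state X T = T (delta []) []"
proof -
  have "vacuum_state X T = (\<Sum>\<^sub>\<infinity>w\<in>{[]}. T (delta []) w * cnj (delta [] w))"
    unfolding vacuum_state_def l2_inner_def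
    by (rule infsum_cong_neutral) (use assms in \<open>auto simp: delta_def\<close>)
  then show ?thesis by (simp add: delta_def)
qed

lemma fin_suppI:
  assumes "finite S" "\<And>w. f w \<noteq> 0 \<Longrightarrow> w \<in> S \<and> w \<in> X"
  shows "f \<in> fin_supp X"
  using assms by (auto simp: fin_supp_def supp_def intro: finite_subset[of _ S])

lemma poly_op_fin_supp:
  assumes "\<And>\<xi>. \<xi> \<in> fin_supp X \<Longrightarrow> T \<xi> \<in> fin_supp X" "\<xi> \<in> fin_supp X"
  shows "poly_op p T \<xi> \<in> fin_supp X"
proof (rule fin_suppI)
  have iter: "(T ^^ k) \<xi> \<in> fin_supp X" for k
    by (induction k) (use assms in auto)
  show "finite (\<Union>k\<le>degree p. supp ((T ^^ k) \<xi>))"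
    using iter by (auto simp: fin_supp_def)
  fix w assume "poly_op p T \<xi> w \<noteq> 0"
  then obtain k where "k \<le> degree p" "coeff p k * (T ^^ k) \<xi> w \<noteq> 0"
    unfolding poly_op_def by (auto elim: sum.not_neutral_contains_not_neutral)
  then show "w \<in> (\<Union>k\<le>degree p. supp ((T ^^ k) \<xi>)) \<and> w \<in> X"
    using iter[of k] by (auto simp: fin_supp_def supp_def)
qed

section \<open>Splitting words and the edges of one index\<close>

locale rooted_graph_family =
  fixes I :: "'i set"
    and V :: "'i \<Rightarrow> 'a set"
    and E :: "'i \<Rightarrow> 'a set set"
    and rt :: "'i \<Rightarrow> 'a"
  assumes finite_I: "finite I"
    and rooted: "\<And>i. i \<in> I \<Longrightarrow> rooted_graph (V i) (E i) (rt i)"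
begin

abbreviation "X \<equiv> free_words I V rt"

definition avoids :: "'i \<Rightarrow> ('i, 'a) word \<Rightarrow> bool" where
  "avoids i u \<longleftrightarrow> (u \<noteq> [] \<longrightarrow> fst (hd u) \<noteq> i)"

text \<open>The root stands for an absent letter, so that \<open>letter i\<close> and
  \<open>rest i\<close> together invert \<open>lmult\<close> on words avoiding
  \<open>i\<close>.\<close>

definition letter :: "'i \<Rightarrow> ('i, 'a) word \<Rightarrow> 'a" where
  "letter i w = (if avoids i w then rt i else snd (hd w))"

definition rest :: "'i \<Rightarrow> ('i, 'a) word \<Rightarrow> ('i, 'a) word" where
  "rest i w = (if avoids i w then w else tl w)"

text \<open>A limit-free formula for \<open>A_component\<close> on finitely supported vectors. The
  value 0 outside \<open>X\<close> keeps the image in \<open>fin_supp X\<close>.\<close>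

definition component_op :: "'i \<Rightarrow> ('i, 'a) word oper" where
  "component_op i \<xi> w = (if w \<in> X
     then \<Sum>v\<in>neighbours (E i) (letter i w). \<xi> (lmult rt i v (rest i w)) else 0)"

text \<open>The oriented form of an edge of index \<open>i\<close>. Requiring \<open>u\<close> to
  avoid \<open>i\<close> replaces the condition in \<open>free_edges\<close> that both products be
  reduced.\<close>

definition step :: "'i \<Rightarrow> ('i, 'a) word \<Rightarrow> ('i, 'a) word \<Rightarrow> bool" where
  "step i w w' \<longleftrightarrow> (\<exists>v v' u. {v, v'} \<in> E i \<and> u \<in> X \<and> avoids i u \<and>
     w = lmult rt i v u \<and> w' = lmult rt i v' u)"

lemma edgeD:
  assumes "i \<in> I" "{v, v'} \<in> E i"
  shows "v \<in> V i" "v' \<in> V i" "v \<noteq> v'"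
proof -
  have "\<forall>f\<in>E i. f \<subseteq> V i \<and> card f = 2"
    using rooted[OF assms(1)] by (simp add: rooted_graph_def simple_graph_def)
  from bspec[OF this assms(2)] have "{v, v'} \<subseteq> V i" "card {v, v'} = 2"
    by auto
  then show "v \<in> V i" "v' \<in> V i" "v \<noteq> v'"
    by auto
qed

lemma finite_neighbours: "i \<in> I \<Longrightarrow> v \<in> V i \<Longrightarrow> finite (neighbours (E i) v)"
  using rooted[of i] by (simp add: rooted_graph_def)

lemma root_in: "i \<in> I \<Longrightarrow> rt i \<in> V i"
  using rooted[of i] by (simp add: rooted_graph_def)

lemma Nil_in_X: "[] \<in> X"
  by (simp add: free_words_def)

lemma lmult_in_X: "i \<in> I \<Longrightarrow> v \<in> V i \<Longrightarrow> u \<in> X \<Longrightarrow> avoids i u \<Longrightarrow> lmult rt i v u \<in> X"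
  by (cases u) (simp_all add: lmult_def free_words_def avoids_def)

lemma letter_lmult: "avoids i u \<Longrightarrow> letter i (lmult rt i v u) = v"
  by (auto simp: lmult_def letter_def avoids_def)

lemma rest_lmult: "avoids i u \<Longrightarrow> rest i (lmult rt i v u) = u"
  by (auto simp: lmult_def rest_def avoids_def)

lemma letter_in: "i \<in> I \<Longrightarrow> w \<in> X \<Longrightarrow> letter i w \<in> V i"
  using root_in by (cases w) (auto simp: letter_def avoids_def free_words_def)

lemma rest_in_X: "w \<in> X \<Longrightarrow> rest i w \<in> X"
  by (cases w) (auto simp: rest_def free_words_def distinct_adj_Cons)

lemma avoids_rest: "w \<in> X \<Longrightarrow> avoids i (rest i w)"
  by (cases w; cases "tl w") (auto simp: rest_def avoids_def free_words_def)

lemma lmult_letter_rest: "w \<in> X \<Longrightarrow> lmult rt i (letter i w) (rest i w) = w"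
  by (cases w) (auto simp: lmult_def letter_def rest_def avoids_def free_words_def)

lemma inj_on_lmult: "inj_on (\<lambda>v. lmult rt i v u) S"
  by (auto simp: inj_on_def lmult_def split: if_splits)

lemma stepI:
  "\<lbrakk>{v, v'} \<in> E i; u \<in> X; avoids i u\<rbrakk> \<Longrightarrow> step i (lmult rt i v u) (lmult rt i v' u)"
  unfolding step_def by blast

lemma stepE:
  assumes "step i w w'"
  obtains v v' u where "{v, v'} \<in> E i" "u \<in> X" "avoids i u"
    "w = lmult rt i v u" "w' = lmult rt i v' u"
  using assms unfolding step_def by blast

lemma step_sym: "step i w w' \<longleftrightarrow> step i w' w"
proof -
  have "step i y x" if "step i x y" for x y
    using that by (rule stepE) (simp add: stepI insert_commute)
  then show ?thesis by blast
qed

lemma step_in_X: "i \<in> I \<Longrightarrow> step i w w' \<Longrightarrow> w \<in> X \<and> w' \<in> X"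
  by (erule stepE) (auto intro!: lmult_in_X dest: edgeD)

text \<open>The splitting is unique, so \<open>u\<close> has to be \<open>rest i w\<close> and the
  edge has to start at \<open>letter i w\<close>.\<close>

lemma step_iff:
  assumes "i \<in> I" "w \<in> X"
  shows "step i w w' \<longleftrightarrow> w' \<in> (\<lambda>v. lmult rt i v (rest i w)) ` neighbours (E i) (letter i w)"
proof
  assume "step i w w'"
  then show "w' \<in> (\<lambda>v. lmult rt i v (rest i w)) ` neighbours (E i) (letter i w)"
    by (rule stepE) (auto simp: rest_lmult letter_lmult neighbours_def)
next
  assume "w' \<in> (\<lambda>v. lmult rt i v (rest i w)) ` neighbours (E i) (letter i w)"
  then obtain v where "{letter i w, v} \<in> E i" "w' = lmult rt i v (rest i w)"
    by (auto simp: neighbours_def)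
  then show "step i w w'"
    using stepI[of "letter i w" v i "rest i w"] lmult_letter_rest rest_in_X avoids_rest assms(2)
    by simp
qed

lemma finite_step: "i \<in> I \<Longrightarrow> w \<in> X \<Longrightarrow> finite {w'. step i w w'}"
  by (simp add: step_iff finite_neighbours letter_in)

text \<open>The endpoints of an edge differ, so at least one carries a letter in front of the common
  tail. A longer endpoint, or both if the lengths agree, thus shows the index as its first
  one.\<close>

lemma step_index_unique:
  assumes "i \<in> I" "j \<in> I" "step i w w'" "step j w w'"
  shows "i = j"
proof -
  from assms(3) obtain v v' u where i: "{v, v'} \<in> E i" "w = lmult rt i v u" "w' = lmult rt i v' u"
    by (rule stepE)
  from assms(4) obtain x x' y where j: "{x, x'} \<in> E j" "w = lmult rt j x y" "w' = lmult rt j x' y"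
    by (rule stepE)
  show ?thesis
    using edgeD(3)[OF assms(1) i(1)] edgeD(3)[OF assms(2) j(1)] i(2,3) j(2,3)
    by (auto simp: lmult_def split: if_splits)
qed

lemma sum_step:
  assumes "i \<in> I" "w \<in> X" "finite (supp \<xi>)"
  shows "(\<Sum>w'\<in>supp \<xi>. of_bool (step i w w') * \<xi> w') = component_op i \<xi> w"
proof -
  let ?N = "(\<lambda>v. lmult rt i v (rest i w)) ` neighbours (E i) (letter i w)"
  have fin: "finite ?N"
    using assms finite_neighbours letter_in by blast
  have "(\<Sum>w'\<in>supp \<xi>. of_bool (step i w w') * \<xi> w') = (\<Sum>w'\<in>?N. \<xi> w')"
    \<comment> \<open>The terms outside the intersection of the two index sets vanish: on one side
      \<open>step\<close> fails, on the other xi is 0.\<close>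
    by (rule sum.mono_neutral_cong)
       (use assms fin in \<open>auto simp: step_iff supp_def\<close>)
  also have "\<dots> = component_op i \<xi> w"
    using assms by (simp add: component_op_def sum.reindex[OF inj_on_lmult])
  finally show ?thesis .
qed

section \<open>Levels of the component operators and strong convergence\<close>

lemma component_op_nonzeroD:
  assumes "i \<in> I" "component_op i \<xi> w \<noteq> 0"
  obtains w' where "w' \<in> supp \<xi>" "step i w w'" "w \<in> X"
proof -
  have w: "w \<in> X"
    using assms by (auto simp: component_op_def split: if_splits)
  then have "(\<Sum>v\<in>neighbours (E i) (letter i w). \<xi> (lmult rt i v (rest i w))) \<noteq> 0"
    using assms by (simp add: component_op_def)
  then obtain v where "v \<in> neighbours (E i) (letter i w)" "\<xi> (lmult rt i v (rest i w)) \<noteq> 0"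
    by (rule sum.not_neutral_contains_not_neutral)
  then have "lmult rt i v (rest i w) \<in> supp \<xi>" "step i w (lmult rt i v (rest i w))"
    using step_iff[OF assms(1) w] by (simp_all add: supp_def)
  with w show ?thesis
    by (rule that[rotated 2])
qed

lemma component_op_fin_supp:
  assumes "i \<in> I" "\<xi> \<in> fin_supp X"
  shows "component_op i \<xi> \<in> fin_supp X"
proof (rule fin_suppI)
  show "finite (\<Union>w'\<in>supp \<xi>. {w. step i w' w})"
    using assms finite_step by (auto simp: fin_supp_def)
  fix w assume "component_op i \<xi> w \<noteq> 0"
  then show "w \<in> (\<Union>w'\<in>supp \<xi>. {w. step i w' w}) \<and> w \<in> X"
    by (rule component_op_nonzeroD[OF assms(1)]) (auto simp: step_sym[of i w])
qed

text \<open>Symmetry of \<open>step\<close> orients the unordered pair, and the common tail is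
  recovered as \<open>rest i w\<close>. Hence the levels partition the edges of index
  \<open>i\<close> by tail length.\<close>

lemma level_matrix_iff:
  assumes "i \<in> I"
  shows "(\<exists>x x' u. {x, x'} \<in> E i \<and> u \<in> words_avoiding I V rt i m \<and>
      {w, w'} = {lmult rt i x u, lmult rt i x' u}) \<longleftrightarrow> step i w w' \<and> length (rest i w) = m"
    (is "?L \<longleftrightarrow> ?R")
proof
  assume ?L
  then obtain x x' u where u: "{x, x'} \<in> E i" "u \<in> X" "avoids i u" "length u = m"
    and w: "{w, w'} = {lmult rt i x u, lmult rt i x' u}"
    by (auto simp: words_avoiding_def avoids_def)
  have "step i (lmult rt i x u) (lmult rt i x' u)"
    by (rule stepI) (use u in auto)
  with w have "step i w w'"
    using step_sym[of i w w'] by (auto simp: doubleton_eq_iff)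
  with w u show ?R
    by (auto simp: doubleton_eq_iff rest_lmult)
next
  assume ?R
  then obtain x x' u where "{x, x'} \<in> E i" "u \<in> X" "avoids i u" "length u = m"
    "w = lmult rt i x u" "w' = lmult rt i x' u"
    by (auto simp: rest_lmult elim!: stepE)
  moreover from this have "u \<in> words_avoiding I V rt i m"
    by (simp add: words_avoiding_def avoids_def)
  ultimately show ?L
    by blast
qed

lemma A_level_eq:
  assumes "i \<in> I" "\<xi> \<in> fin_supp X"
  shows "A_level I V E rt i n \<xi> w = (if length (rest i w) = n - 1 then component_op i \<xi> w else 0)"
proof (cases "w \<in> X")
  case True
  have "A_level I V E rt i n \<xi> w =
      (\<Sum>w'\<in>supp \<xi>. of_bool (step i w w' \<and> length (rest i w) = n - 1) * \<xi> w')"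
    unfolding A_level_def matrix_op_def level_matrix_iff[OF assms(1)]
    by (intro sum.cong) auto
  also have "\<dots> = (if length (rest i w) = n - 1 then component_op i \<xi> w else 0)"
    using sum_step[OF assms(1) True, of \<xi>] assms by (simp add: fin_supp_def)
  finally show ?thesis .
next
  case False
  then have "\<not> step i w w'" for w'
    using step_in_X[OF assms(1)] by blast
  with False show ?thesis
    unfolding A_level_def matrix_op_def level_matrix_iff[OF assms(1)] by (simp add: component_op_def)
qed

lemma A_level_limit_iff:
  assumes "i \<in> I" "\<xi> \<in> fin_supp X"
  shows "l2_series_limit X (\<lambda>n. A_level I V E rt i n \<xi>) \<eta> \<longleftrightarrow> \<eta> = component_op i \<xi>"
proof (rule l2_series_limit_of_eventually_constant)
  note c = component_op_fin_supp[OF assms]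
  show "component_op i \<xi> \<in> l2_space X"
    by (rule fin_supp_in_l2_space[OF c])
  show "A_level I V E rt i n \<xi> \<in> l2_space X" for n
    by (intro fin_supp_in_l2_space fin_suppI[of "supp (component_op i \<xi>)"])
       (use c in \<open>auto simp: A_level_eq[OF assms] fin_supp_def supp_def split: if_splits\<close>)
  \<comment> \<open>The bound is uniform over the finite support, and strict so that
    \<open>Suc (length (rest i w))\<close> is at most \<open>M\<close>.\<close>
  obtain M where M: "\<And>w. w \<in> supp (component_op i \<xi>) \<Longrightarrow> length (rest i w) < M"
    using c finite_nat_set_iff_bounded[of "(\<lambda>w. length (rest i w)) ` supp (component_op i \<xi>)"]
    by (auto simp: fin_supp_def)
  show "\<forall>\<^sub>F N in sequentially. \<forall>w. (\<Sum>n=1..N. A_level I V E rt i n \<xi> w) = component_op i \<xi> w"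
    unfolding eventually_sequentially
  proof (intro exI[of _ M] allI impI)
    fix N w assume N: "M \<le> N"
    \<comment> \<open>Truncated subtraction gives levels 0 and 1 the same tail length; since the sum
      starts at 1, exactly one level sees \<open>w\<close>.\<close>
    have "(\<Sum>n=1..N. A_level I V E rt i n \<xi> w) =
        (\<Sum>n=1..N. if n = Suc (length (rest i w)) then component_op i \<xi> w else 0)"
      by (rule sum.cong) (auto simp: A_level_eq[OF assms])
    also have "\<dots> = component_op i \<xi> w"
      using M[of w] N by (cases "component_op i \<xi> w = 0") (simp_all add: supp_def)
    finally show "(\<Sum>n=1..N. A_level I V E rt i n \<xi> w) = component_op i \<xi> w" .
  qed
qed

lemma A_component_eq:
  assumes "i \<in> I" "\<xi> \<in> fin_supp X"
  shows "A_component I V E rt i \<xi> = component_op i \<xi>"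
  unfolding A_component_def strong_series_def A_level_limit_iff[OF assms] by simp

section \<open>The adjacency operator as the sum of its components\<close>

lemma neighbours_free_edges:
  "neighbours (free_edges I V E rt) w = (\<Union>i\<in>I. {w'. step i w w'})"
proof (intro set_eqI iffI)
  fix w' assume "w' \<in> neighbours (free_edges I V E rt) w"
  then obtain i v v' u where *: "i \<in> I" "{v, v'} \<in> E i" "u \<in> X"
      "lmult rt i v u \<in> X" "lmult rt i v' u \<in> X"
      "{w, w'} = {lmult rt i v u, lmult rt i v' u}"
    by (auto simp: neighbours_def free_edges_def)
  \<comment> \<open>One of the distinct vertices \<open>v\<close>, \<open>v'\<close> is not the
    root, and its product with \<open>u\<close> is reduced, so \<open>u\<close> cannot begin with
    index \<open>i\<close>.\<close>
  have "avoids i u"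
    using *(4,5) edgeD(3)[OF *(1,2)]
    by (cases u) (auto simp: avoids_def lmult_def free_words_def split: if_splits)
  then have "step i (lmult rt i v u) (lmult rt i v' u)"
    using * by (intro stepI)
  then have "step i w w'"
    using *(6) step_sym[of i w w'] by (auto simp: doubleton_eq_iff)
  with *(1) show "w' \<in> (\<Union>i\<in>I. {w'. step i w w'})"
    by blast
next
  fix w' assume "w' \<in> (\<Union>i\<in>I. {w'. step i w w'})"
  then obtain i where i: "i \<in> I" "step i w w'"
    by blast
  then show "w' \<in> neighbours (free_edges I V E rt) w"
    using step_in_X[OF i] unfolding neighbours_def free_edges_def step_def by blast
qed

text \<open>\<open>adjacency_op\<close> sends mass from \<open>x\<close> to its neighbours, whereas
  \<open>component_op\<close> collects it at \<open>w\<close>; symmetry of \<open>step\<close>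
  matches the two. By \<open>step_index_unique\<close> each edge is counted for one index
  only.\<close>

lemma adjacency_op_eq:
  assumes "\<xi> \<in> fin_supp X"
  shows "adjacency_op (free_edges I V E rt) \<xi> w = (\<Sum>i\<in>I. component_op i \<xi> w)"
proof -
  have X: "x \<in> X" if "x \<in> supp \<xi>" for x
    using that assms by (auto simp: fin_supp_def)
  have count: "(\<Sum>x'\<in>neighbours (free_edges I V E rt) x. delta x' w)
      = (\<Sum>i\<in>I. of_bool (step i w x) :: complex)" if "x \<in> supp \<xi>" for x
  proof -
    have "finite (neighbours (free_edges I V E rt) x)"
      unfolding neighbours_free_edges using finite_I finite_step X[OF that] by blast
    then have "(\<Sum>x'\<in>neighbours (free_edges I V E rt) x. delta x' w)
        = (of_bool (\<exists>i\<in>I. step i w x) :: complex)"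
      by (simp add: sum_delta_eq neighbours_free_edges step_sym[of _ x w])
    also have "\<dots> = (\<Sum>i\<in>I. of_bool (step i w x))"
    proof (cases "\<exists>i\<in>I. step i w x")
      case True
      then obtain j where j: "j \<in> I" "step j w x" by blast
      have "(\<Sum>i\<in>I. of_bool (step i w x) :: complex) = (\<Sum>i\<in>I. if i = j then 1 else 0)"
        by (rule sum.cong) (use j step_index_unique in auto)
      with True j finite_I show ?thesis by simp
    qed simp
    finally show ?thesis .
  qed
  have "adjacency_op (free_edges I V E rt) \<xi> w
      = (\<Sum>x\<in>supp \<xi>. \<Sum>i\<in>I. of_bool (step i w x) * \<xi> x)"
    unfolding adjacency_op_def
    by (rule sum.cong) (simp_all add: count sum_distrib_left mult.commute)
  also have "\<dots> = (\<Sum>i\<in>I. \<Sum>x\<in>supp \<xi>. of_bool (step i w x) * \<xi> x)"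
    by (rule sum.swap)
  also have "\<dots> = (\<Sum>i\<in>I. component_op i \<xi> w)"
  proof (rule sum.cong[OF refl])
    fix i assume i: "i \<in> I"
    show "(\<Sum>x\<in>supp \<xi>. of_bool (step i w x) * \<xi> x) = component_op i \<xi> w"
    proof (cases "w \<in> X")
      case False
      then have "\<not> step i w x" for x
        using step_in_X[OF i] by blast
      with False show ?thesis by (simp add: component_op_def)
    qed (use sum_step i assms in \<open>auto simp: fin_supp_def\<close>)
  qed
  finally show ?thesis .
qed

section \<open>Linearity and free independence\<close>

lemma A_component_linear:
  assumes i: "i \<in> I"
  shows "linear_operator_on (fin_supp X) (A_component I V E rt i)"
proof -
  have add: "(\<lambda>w. \<xi> w + \<eta> w) \<in> fin_supp X" if "\<xi> \<in> fin_supp X" "\<eta> \<in> fin_supp X" for \<xi> \<eta>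
    by (rule fin_suppI[of "supp \<xi> \<union> supp \<eta>"]) (use that in \<open>force simp: fin_supp_def supp_def\<close>)+
  have scale: "(\<lambda>w. c * \<xi> w) \<in> fin_supp X" if "\<xi> \<in> fin_supp X" for c \<xi>
    by (rule fin_suppI[of "supp \<xi>"]) (use that in \<open>auto simp: fin_supp_def supp_def\<close>)
  show ?thesis
    unfolding linear_operator_on_def
    by (auto simp: A_component_eq[OF i] add scale component_op_fin_supp[OF i])
       (auto simp: component_op_def sum.distrib sum_distrib_left)
qed

text \<open>In the coordinates (letter, rest), xi is the delta function at the root tensored with
  its restriction to avoiding words. The operator acts on the first factor only, so the second
  survives as the scalar \<open>\<xi> u\<close>.\<close>

lemma component_op_pow_lmult:
  assumes i: "i \<in> I" and \<xi>: "\<And>w. \<xi> w \<noteq> 0 \<Longrightarrow> avoids i w"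
    and u: "u \<in> X" "avoids i u" and v: "v \<in> V i"
  shows "(component_op i ^^ k) \<xi> (lmult rt i v u)
    = \<xi> u * (component_op i ^^ k) (delta []) (lmult rt i v [])"
  using v
\<comment> \<open>The successor step evaluates the \<open>k\<close>-th power at the neighbours of
  \<open>v\<close>.\<close>
proof (induction k arbitrary: v)
  case 0
  have "\<xi> ((i, v) # u) = 0"
    using \<xi>[of "(i, v) # u"] by (auto simp: avoids_def)
  then show ?case
    by (auto simp: lmult_def delta_def)
next
  case (Suc k)
  have Nil: "avoids i []"
    by (simp add: avoids_def)
  have "v' \<in> V i" if "v' \<in> neighbours (E i) v" for v'
    using that edgeD[OF i] by (auto simp: neighbours_def)
  then show ?case
    using Suc lmult_in_X[OF i Suc.prems] u Nil Nil_in_X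
    by (simp add: component_op_def letter_lmult rest_lmult sum_distrib_left)
qed

lemma A_component_pow_eq:
  assumes "i \<in> I" "\<xi> \<in> fin_supp X"
  shows "(A_component I V E rt i ^^ k) \<xi> = (component_op i ^^ k) \<xi>"
proof -
  \<comment> \<open>The two operators are compared on \<open>fin_supp X\<close> only, so membership
    is carried through the induction.\<close>
  have "(A_component I V E rt i ^^ k) \<xi> = (component_op i ^^ k) \<xi> \<and>
      (component_op i ^^ k) \<xi> \<in> fin_supp X"
    by (induction k) (use assms A_component_eq component_op_fin_supp in auto)
  then show ?thesis ..
qed

lemma delta_Nil_fin_supp: "delta [] \<in> fin_supp X"
  by (rule fin_suppI[of "{[]}"]) (auto simp: delta_def Nil_in_X split: if_splits)

text \<open>This is the case \<open>v = rt i\<close> of \<open>component_op_pow_lmult\<close>: the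
  scalar factors are vacuum moments, which the coefficients of \<open>p\<close> combine into the
  state of the polynomial.\<close>

lemma poly_op_A_component_at:
  assumes i: "i \<in> I" and \<xi>: "\<xi> \<in> fin_supp X" "\<And>w. \<xi> w \<noteq> 0 \<Longrightarrow> avoids i w"
    and u: "u \<in> X" "avoids i u"
  shows "poly_op p (A_component I V E rt i) \<xi> u
    = \<xi> u * vacuum_state X (poly_op p (A_component I V E rt i))"
proof -
  have "(component_op i ^^ k) \<xi> u = \<xi> u * (component_op i ^^ k) (delta []) []" for k
    using component_op_pow_lmult[OF i \<xi>(2) u root_in[OF i]] by (simp add: lmult_def)
  then show ?thesis
    by (simp add: vacuum_state_eq[OF Nil_in_X] poly_op_def A_component_pow_eq[OF i] \<xi>(1)
        delta_Nil_fin_supp sum_distrib_left mult.left_commute)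
qed

text \<open>Stating the first index through \<open>take 1\<close> lets the empty product, whose
  vector is \<open>delta []\<close>, satisfy the same claim and start the induction.\<close>

lemma alternating_product_supp:
  assumes "length as = length is" "set is \<subseteq> I" "distinct_adj is"
    and "\<forall>k<length is. as ! k \<in> generated_algebra (A_component I V E rt (is ! k)) \<and>
      vacuum_state X (as ! k) = 0"
  defines "\<xi> \<equiv> foldr (\<circ>) as id (delta [])"
  shows "\<xi> \<in> fin_supp X \<and> (\<forall>w. \<xi> w \<noteq> 0 \<longrightarrow> map fst (take 1 w) = take 1 is)"
  using assms(1-4) unfolding \<xi>_def
proof (induction "as" "is" rule: list_induct2)
  case Nil
  then show ?case
    by (auto simp: delta_Nil_fin_supp) (auto simp: delta_def split: if_splits)
next
  case (Cons a as' i is')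
  define \<eta> where "\<eta> = foldr (\<circ>) as' id (delta [])"
  have "\<forall>k<length is'. as' ! k \<in> generated_algebra (A_component I V E rt (is' ! k)) \<and>
      vacuum_state X (as' ! k) = 0"
    using Cons.prems(3) by (auto dest: spec[of _ "Suc _"])
  moreover have "set is' \<subseteq> I" "distinct_adj is'"
    using Cons.prems(1,2) by (auto simp: distinct_adj_Cons)
  ultimately have \<eta>: "\<eta> \<in> fin_supp X" "\<And>w. \<eta> w \<noteq> 0 \<Longrightarrow> map fst (take 1 w) = take 1 is'"
    using Cons.IH unfolding \<eta>_def by blast+
  have i: "i \<in> I"
    using Cons.prems by simp
  obtain p where a: "a = poly_op p (A_component I V E rt i)" and a0: "vacuum_state X a = 0"
    using Cons.prems(3) by (force simp: generated_algebra_def)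
  \<comment> \<open>A word in the support of eta is empty or begins with the head of
    \<open>is'\<close>, which differs from \<open>i\<close> by alternation.\<close>
  have avoids: "avoids i w" if "\<eta> w \<noteq> 0" for w
    using \<eta>(2)[OF that] Cons.prems(2)
    by (cases w; cases is') (auto simp: avoids_def)
  have fin: "a \<eta> \<in> fin_supp X"
    unfolding a using poly_op_fin_supp[OF _ \<eta>(1)] A_component_eq[OF i] component_op_fin_supp[OF i]
    by simp
  have "map fst (take 1 w) = [i]" if w: "a \<eta> w \<noteq> 0" for w
  proof -
    have "w \<in> X"
      using fin w by (auto simp: fin_supp_def supp_def)
    \<comment> \<open>At a word avoiding \<open>i\<close> the value would be \<open>\<eta> w\<close>
      times the state of \<open>a\<close>, which is 0.\<close>
    then have "\<not> avoids i w"
      using poly_op_A_component_at[OF i \<eta>(1) avoids] w a a0 by auto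
    then show ?thesis
      by (cases w) (auto simp: avoids_def)
  qed
  moreover have "foldr (\<circ>) (a # as') id (delta []) = a \<eta>"
    by (simp only: foldr.simps o_apply \<eta>_def)
  ultimately show ?case
    using fin by (simp only:) simp
qed

lemma A_components_free: "freely_independent (fin_supp X) (vacuum_state X) I (A_component I V E rt)"
  unfolding freely_independent_def free_algebras_def
proof (intro conjI ballI allI impI A_component_linear; (elim conjE)?)
  fix "is" "as"
  assume "is \<noteq> []" and "length as = length is" "set is \<subseteq> I" "distinct_adj is"
    "\<forall>k<length is. as ! k \<in> generated_algebra (A_component I V E rt (is ! k)) \<and>
      vacuum_state X (as ! k) = 0"
  \<comment> \<open>The state is the value at \<open>[]\<close>, which has no first index, while
    \<open>take 1 is\<close> is nonempty.\<close>
  with alternating_product_supp[of "as" "is"]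
  show "vacuum_state X (foldr (\<circ>) as id) = 0"
    by (cases "is") (auto simp: vacuum_state_eq[OF Nil_in_X])
qed

end

theorem theorem6p2:
  fixes I :: "'i set"
    and V :: "'i \<Rightarrow> 'a set"
    and E :: "'i \<Rightarrow> 'a set set"
    and rt :: "'i \<Rightarrow> 'a"
  assumes "finite I"
    and "\<And>i. i \<in> I \<Longrightarrow> rooted_graph (V i) (E i) (rt i)"
  shows "(\<forall>i\<in>I. series_converges_strongly (free_words I V rt) (A_level I V E rt i)) \<and>
    (\<forall>\<xi>\<in>fin_supp (free_words I V rt).
       adjacency_op (free_edges I V E rt) \<xi> = (\<lambda>w. \<Sum>i\<in>I. A_component I V E rt i \<xi> w)) \<and>
    freely_independent (fin_supp (free_words I V rt)) (vacuum_state (free_words I V rt)) I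
      (A_component I V E rt)"
proof -
  interpret rooted_graph_family I V E rt
    by unfold_locales (use assms in auto)
  show ?thesis
    using A_components_free A_level_limit_iff
    by (auto simp: series_converges_strongly_def adjacency_op_eq A_component_eq fun_eq_iff
        intro!: sum.cong)
qed

end
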